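(* Let $m \ge 4$ be an even integer, $n \ge 3$ an odd integer, and $s$ an integer with $\mathrm{ord}_n(s) = 2$. Assume that $\mathrm{lcm}\left(\frac{m}{2}, n\right) \ge m+n-1$. Then it is not the case that both $\mathsf{d}(G_{m,n,s}) = m+n-2$ and $\mathsf{E}(G_{m,n,s}) = mn+m+n-2$ hold. In particular, for $m \ge 4$ even, $n \ge 3$ odd and $\mathrm{ord}_n(s)=2$, if $\gcd\left(\frac{m}{2}, n\right) = 1$, then $\mathsf{d}(G_{m,n,s}) = \frac{mn}{2}$, $\mathsf{E}(G_{m,n,s}) \ge \frac{3mn}{2}$, and it is not the case that both $\mathsf{d}(G_{m,n,s}) = m+n-2$ and $\mathsf{E}(G_{m,n,s}) = mn+m+n-2$ hold.
   Context: For an integer $s$ coprime to $n$, $\mathrm{ord}_n(s)$ is the multiplicative order of $s$ modulo $n$. For positive integers $m,n$ and an integer $s$ with $s^m \equiv 1 \pmod n$ (equivalently $\mathrm{ord}_n(s) \mid m$), $G_{m,n,s} = C_n \rtimes_s C_m = \langle x, y \mid x^m = y^n = 1,\ yx = xy^s\rangle$, a metacyclic group of order $mn$. Let $G$ be a finite multiplicative group. A sequence over $G$ is a finite unordered collection of elements of $G$ with repetition allowed (a finite multiset); its length $|S|$ is the number of terms counted with multiplicity, and a subsequence is a sub-multiset. A sequence $S$ with terms $g_1,\dots,g_k$ is a product-one sequence if there is a permutation $\tau$ of $\{1,\dots,k\}$ with $g_{\tau(1)} \cdots g_{\tau(k)} = 1$. $S$ is product-one free if no nonempty subsequence of $S$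 is a product-one sequence. The small Davenport constant $\mathsf{d}(G)$ is the maximal length of a product-one free sequence over $G$. The Gao constant $\mathsf{E}(G)$ is the smallest $\ell > 0$ such that every sequence $S$ over $G$ of length $|S| \ge \ell$ has a product-one subsequence of length exactly $|G|$. *)

theory Defs
  imports
    "HOL-Algebra.Algebra"
    "HOL-Number_Theory.Number_Theory"
    "HOL-Library.Multiset"
begin

section \<open>Product-one sequences and the two constants\<close>

text \<open>
  A sequence over \<open>G\<close> is a finite multiset over \<open>carrier G\<close>, and a subsequence is a
  sub-multiset.  Some ordering of the terms has to multiply to the identity.
\<close>

definition product_one :: "('a, 'b) monoid_scheme \<Rightarrow> 'a multiset \<Rightarrow> bool" where
  "product_one G S \<longleftrightarrow> (\<exists>gs. mset gs = S \<and> foldr (\<otimes>\<^bsub>G\<^esub>) gs \<one>\<^bsub>G\<^esub> = \<one>\<^bsub>G\<^esub>)"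

definition product_one_free :: "('a, 'b) monoid_scheme \<Rightarrow> 'a multiset \<Rightarrow> bool" where
  "product_one_free G S \<longleftrightarrow> (\<forall>T. T \<subseteq># S \<and> T \<noteq> {#} \<longrightarrow> \<not> product_one G T)"

text \<open>The maximum and the minimum below exist for every finite group;
  see \<open>finite_free_lengths\<close>, \<open>free_lengths_nonempty\<close> and \<open>gao_constant_exists\<close>.\<close>

definition small_davenport :: "('a, 'b) monoid_scheme \<Rightarrow> nat" where
  "small_davenport G = Max {size S | S. set_mset S \<subseteq> carrier G \<and> product_one_free G S}"

definition gao_constant :: "('a, 'b) monoid_scheme \<Rightarrow> nat" where
  "gao_constant G = (LEAST l. l > 0 \<and>
     (\<forall>S. set_mset S \<subseteq> carrier G \<and> size S \<ge> l \<longrightarrow>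
        (\<exists>T. T \<subseteq># S \<and> size T = order G \<and> product_one G T)))"

lemma (in group) long_sequence_product_one:
  assumes fin: "finite (carrier G)" and S: "set_mset S \<subseteq> carrier G"
    and len: "size S \<ge> order G * order G"
  shows "\<exists>T. T \<subseteq># S \<and> size T = order G \<and> product_one G T"
proof -
  have pos: "order G > 0"
    using fin by (simp add: order_gt_0_iff_finite)
  have "\<exists>g \<in> carrier G. count S g \<ge> order G"
  proof (rule ccontr)
    assume "\<not> ?thesis"
    then have small: "count S g \<le> order G - 1" if "g \<in> carrier G" for g
      using that pos by (force simp: not_le)
    have "size S = (\<Sum>g \<in> carrier G. count S g)"
      unfolding size_multiset_overloaded_eq
      by (rule sum.mono_neutral_left) (use fin S in \<open>auto simp: not_in_iff\<close>)
    also have "\<dots> \<le> order G * (order G - 1)"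
      using sum_bounded_above[OF small] by (simp add: order_def)
    also have "\<dots> < order G * order G"
      using pos by simp
    finally show False
      using len by simp
  qed
  then obtain g where g: "g \<in> carrier G" "count S g \<ge> order G" by blast
  have "foldr (\<otimes>) (replicate k g) \<one> = g [^] k" for k :: nat
  proof (induction k)
    case (Suc k)
    then show ?case
      using nat_pow_Suc2[OF g(1), of k] by simp
  qed simp
  then have "product_one G (replicate_mset (order G) g)"
    unfolding product_one_def
    using pow_order_eq_1[OF g(1)] by (intro exI[of _ "replicate (order G) g"]) simp
  then show ?thesis
    using g(2) by (intro exI[of _ "replicate_mset (order G) g"]) (simp add: count_le_replicate_mset_subset_eq)
qed

lemma (in group) finite_free_lengths:
  assumes "finite (carrier G)"
  shows "finite {size S | S. set_mset S \<subseteq> carrier G \<and> product_one_free G S}"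
proof (rule finite_subset)
  have "order G > 0"
    using assms by (simp add: order_gt_0_iff_finite)
  then have "size S \<le> order G * order G"
    if "set_mset S \<subseteq> carrier G" "product_one_free G S" for S
    using long_sequence_product_one[OF assms that(1)] that(2)
    by (cases "size S \<ge> order G * order G") (auto simp: product_one_free_def)
  then show "{size S | S. set_mset S \<subseteq> carrier G \<and> product_one_free G S} \<subseteq> {..order G * order G}"
    by auto
qed simp

lemma free_lengths_nonempty:
  "{size S | S. set_mset S \<subseteq> carrier G \<and> product_one_free G S} \<noteq> {}"
proof -
  have "set_mset {#} \<subseteq> carrier G \<and> product_one_free G {#}"
    by (simp add: product_one_free_def)
  then show ?thesis by blast
qed

lemma (in group) gao_constant_exists:
  assumes "finite (carrier G)"
  shows "\<exists>l > 0. \<forall>S. set_mset S \<subseteq> carrier G \<and> size S \<ge> l \<longrightarrow>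
           (\<exists>T. T \<subseteq># S \<and> size T = order G \<and> product_one G T)"
  using long_sequence_product_one[OF assms] assms
  by (intro exI[of _ "order G * order G"]) (auto simp: order_gt_0_iff_finite)


section \<open>The metacyclic group\<close>

text \<open>
  The pair \<open>(a, b)\<close> stands for \<open>x^a y^b\<close>, and the relation \<open>y x = x y^s\<close> gives
  \<open>(x^a y^b) (x^c y^d) = x^(a + c) y^(b s^c + d)\<close>.  This is a group if \<open>s^m \<equiv> 1\<close> modulo \<open>n\<close>.
  By \<open>metacyclic_relations\<close>, \<open>metacyclic_elem\<close> and \<open>metacyclic_hom\<close> it is then the group presented
  by \<open>\<langle>x, y | x^m = y^n = 1, y x = x y^s\<rangle>\<close>, of order \<open>m n\<close>.
\<close>

definition metacyclic :: "nat \<Rightarrow> nat \<Rightarrow> int \<Rightarrow> (int \<times> int) monoid" where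
  "metacyclic m n s =
     \<lparr>carrier = carrier (integer_mod_group m) \<times> carrier (integer_mod_group n),
      monoid.mult = (\<lambda>(a, b) (c, d). ((a + c) mod int m, (b * s ^ nat c + d) mod int n)),
      one = (0, 0)\<rparr>"

lemma carrier_metacyclic:
  "m > 0 \<Longrightarrow> n > 0 \<Longrightarrow> carrier (metacyclic m n s) = {0..<int m} \<times> {0..<int n}"
  by (simp add: metacyclic_def carrier_integer_mod_group)

lemma mult_metacyclic [simp]:
  "(a, b) \<otimes>\<^bsub>metacyclic m n s\<^esub> (c, d) = ((a + c) mod int m, (b * s ^ nat c + d) mod int n)"
  by (simp add: metacyclic_def)

lemma one_metacyclic [simp]: "\<one>\<^bsub>metacyclic m n s\<^esub> = (0, 0)"
  by (simp add: metacyclic_def)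

lemma order_metacyclic: "m > 0 \<Longrightarrow> n > 0 \<Longrightarrow> order (metacyclic m n s) = m * n"
  by (simp add: order_def carrier_metacyclic card_cartesian_product)

lemma power_mod_exponent:
  fixes s :: int
  assumes "[s ^ m = 1] (mod int n)"
  shows "[s ^ (k mod m) = s ^ k] (mod int n)"
proof -
  have "[s ^ (k mod m) * (s ^ m) ^ (k div m) = s ^ (k mod m) * 1 ^ (k div m)] (mod int n)"
    using assms by (intro cong_mult cong_pow cong_refl)
  then show ?thesis
    by (simp add: cong_sym flip: power_mult power_add)
qed

lemma group_metacyclic:
  assumes "m > 0" "n > 0" and s: "[s ^ m = 1] (mod int n)"
  shows "group (metacyclic m n s)"
proof (rule groupI)
  fix p q r
  assume "p \<in> carrier (metacyclic m n s)" "q \<in> carrier (metacyclic m n s)"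
    "r \<in> carrier (metacyclic m n s)"
  then obtain a b c d e f where pqr: "p = (a, b)" "q = (c, d)" "r = (e, f)"
    and nn: "a \<ge> 0" "c \<ge> 0" "e \<ge> 0"
    using assms by (auto simp: carrier_metacyclic)
  have "[s ^ nat ((c + e) mod int m) = s ^ nat c * s ^ nat e] (mod int n)"
    using power_mod_exponent[OF s, of "nat (c + e)"] nn
    by (simp add: nat_mod_distrib nat_add_distrib power_add)
  then have "[(b * s ^ nat c + d) mod int n * s ^ nat e + f
      = b * s ^ nat ((c + e) mod int m) + (d * s ^ nat e + f) mod int n] (mod int n)"
    (is "[?l = b * ?u + ?v mod _] (mod _)")
  proof -
    assume *: "[?u = s ^ nat c * s ^ nat e] (mod int n)"
    have "[?l = (b * s ^ nat c + d) * s ^ nat e + f] (mod int n)"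
      by (intro cong_add cong_mult cong_refl) simp
    also have "(b * s ^ nat c + d) * s ^ nat e + f = b * (s ^ nat c * s ^ nat e) + ?v"
      by (simp add: algebra_simps)
    also have "[\<dots> = b * ?u + ?v mod int n] (mod int n)"
      using * by (intro cong_add cong_mult cong_refl) (simp_all add: cong_sym)
    finally show ?thesis .
  qed
  then show "p \<otimes>\<^bsub>metacyclic m n s\<^esub> q \<otimes>\<^bsub>metacyclic m n s\<^esub> r
      = p \<otimes>\<^bsub>metacyclic m n s\<^esub> (q \<otimes>\<^bsub>metacyclic m n s\<^esub> r)"
    by (simp add: pqr cong_def mod_add_left_eq mod_add_right_eq add.assoc)
next
  fix p assume "p \<in> carrier (metacyclic m n s)"
  then obtain a b where p: "p = (a, b)" "0 \<le> a" "a < int m" "0 \<le> b" "b < int n"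
    using assms by (auto simp: carrier_metacyclic)
  define c where "c = (- a) mod int m"
  have c: "0 \<le> c" "c < int m" "(c + a) mod int m = 0"
    using assms by (auto simp: c_def mod_add_left_eq)
  define d where "d = (- b * s ^ nat c) mod int n"
  have d: "0 \<le> d" "d < int n"
    using assms by (auto simp: d_def)
  have "int ((nat c + nat a) mod m) = 0"
    using c p by (simp add: zmod_int)
  then have one: "[s ^ nat c * s ^ nat a = 1] (mod int n)"
    using power_mod_exponent[OF s, of "nat c + nat a"] by (simp add: power_add cong_sym)
  have "[d * s ^ nat a + b = (- b * s ^ nat c) * s ^ nat a + b] (mod int n)"
    unfolding d_def by (intro cong_add cong_mult cong_refl) simp
  also have "(- b * s ^ nat c) * s ^ nat a + b = (- b) * (s ^ nat c * s ^ nat a) + b"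
    by (simp add: algebra_simps)
  also have "[\<dots> = (- b) * 1 + b] (mod int n)"
    using one by (intro cong_add cong_mult cong_refl)
  finally have "(d * s ^ nat a + b) mod int n = 0"
    by (simp add: cong_def)
  then show "\<exists>q \<in> carrier (metacyclic m n s). q \<otimes>\<^bsub>metacyclic m n s\<^esub> p = \<one>\<^bsub>metacyclic m n s\<^esub>"
    using assms c d p by (intro bexI[of _ "(c, d)"]) (auto simp: carrier_metacyclic)
qed (use assms in \<open>auto simp: carrier_metacyclic\<close>)

lemma metacyclic_pow_x:
  "m > 0 \<Longrightarrow> n > 0 \<Longrightarrow> (1 mod int m, 0) [^]\<^bsub>metacyclic m n s\<^esub> k = (int k mod int m, 0)"
  by (induction k) (auto simp: nat_pow_def mod_add_eq add.commute)

lemma metacyclic_pow_y: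
  "m > 0 \<Longrightarrow> n > 0 \<Longrightarrow> (0, 1 mod int n) [^]\<^bsub>metacyclic m n s\<^esub> k = (0, int k mod int n)"
  by (induction k) (auto simp: nat_pow_def mod_add_eq add.commute)

lemma metacyclic_elem:
  assumes "a < m" "b < n"
  shows "(1 mod int m, 0) [^]\<^bsub>metacyclic m n s\<^esub> a \<otimes>\<^bsub>metacyclic m n s\<^esub> (0, 1 mod int n) [^]\<^bsub>metacyclic m n s\<^esub> b
    = (int a, int b)"
  using assms by (simp add: metacyclic_pow_x metacyclic_pow_y)

lemma metacyclic_relations:
  assumes "m > 0" "n > 0" and s: "[s ^ m = 1] (mod int n)"
  shows "(1 mod int m, 0) [^]\<^bsub>metacyclic m n s\<^esub> m = \<one>\<^bsub>metacyclic m n s\<^esub>"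
    and "(0, 1 mod int n) [^]\<^bsub>metacyclic m n s\<^esub> n = \<one>\<^bsub>metacyclic m n s\<^esub>"
    and "(0, 1 mod int n) \<otimes>\<^bsub>metacyclic m n s\<^esub> (1 mod int m, 0)
      = (1 mod int m, 0) \<otimes>\<^bsub>metacyclic m n s\<^esub> (0, 1 mod int n) [^]\<^bsub>metacyclic m n s\<^esub> s"
proof -
  interpret M: group "metacyclic m n s"
    using assms by (rule group_metacyclic)
  let ?y = "(0, 1 mod int n)"
  have y: "?y \<in> carrier (metacyclic m n s)"
    using assms by (simp add: carrier_metacyclic)
  show "(1 mod int m, 0) [^]\<^bsub>metacyclic m n s\<^esub> m = \<one>\<^bsub>metacyclic m n s\<^esub>"
    using assms by (simp add: metacyclic_pow_x)
  show yn: "?y [^]\<^bsub>metacyclic m n s\<^esub> n = \<one>\<^bsub>metacyclic m n s\<^esub>"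
    using assms by (simp add: metacyclic_pow_y)
  have "?y [^]\<^bsub>metacyclic m n s\<^esub> s
      = ?y [^]\<^bsub>metacyclic m n s\<^esub> (int n * (s div int n) + s mod int n)"
    by simp
  also have "\<dots> = ?y [^]\<^bsub>metacyclic m n s\<^esub> (s mod int n)"
    using y yn by (subst M.int_pow_mult) (simp_all add: M.int_pow_pow[symmetric] int_pow_int M.int_pow_one del: one_metacyclic)
  also have "\<dots> = ?y [^]\<^bsub>metacyclic m n s\<^esub> nat (s mod int n)"
    using assms int_pow_int[of "metacyclic m n s" ?y "nat (s mod int n)"] by simp
  also have "\<dots> = (0, s mod int n)"
    using assms by (subst metacyclic_pow_y) simp_all
  finally have ys: "?y [^]\<^bsub>metacyclic m n s\<^esub> s = (0, s mod int n)" .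
  have "[s ^ nat (1 mod int m) = s] (mod int n)"
    using power_mod_exponent[OF s, of 1] assms by (simp add: nat_mod_distrib)
  then have "[1 mod int n * s ^ nat (1 mod int m) = 1 * s] (mod int n)"
    by (intro cong_mult) simp_all
  then show "?y \<otimes>\<^bsub>metacyclic m n s\<^esub> (1 mod int m, 0)
      = (1 mod int m, 0) \<otimes>\<^bsub>metacyclic m n s\<^esub> ?y [^]\<^bsub>metacyclic m n s\<^esub> s"
    by (simp add: ys cong_def)
qed

lemma metacyclic_hom:
  assumes "m > 0" "n > 0" "group H" "g \<in> carrier H" "h \<in> carrier H"
    and gm: "g [^]\<^bsub>H\<^esub> m = \<one>\<^bsub>H\<^esub>" and hn: "h [^]\<^bsub>H\<^esub> n = \<one>\<^bsub>H\<^esub>"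
    and rel: "h \<otimes>\<^bsub>H\<^esub> g = g \<otimes>\<^bsub>H\<^esub> h [^]\<^bsub>H\<^esub> s"
  shows "(\<lambda>(a, b). g [^]\<^bsub>H\<^esub> a \<otimes>\<^bsub>H\<^esub> h [^]\<^bsub>H\<^esub> b) \<in> hom (metacyclic m n s) H"
proof -
  interpret H: group H by fact
  note [simp] = \<open>g \<in> carrier H\<close> \<open>h \<in> carrier H\<close>
  have red: "u [^]\<^bsub>H\<^esub> (k mod int l) = u [^]\<^bsub>H\<^esub> k"
    if "u \<in> carrier H" "u [^]\<^bsub>H\<^esub> l = \<one>\<^bsub>H\<^esub>" for u k and l :: nat
  proof -
    have "u [^]\<^bsub>H\<^esub> k = u [^]\<^bsub>H\<^esub> (int l * (k div int l) + k mod int l)"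
      by simp
    also have "\<dots> = u [^]\<^bsub>H\<^esub> (k mod int l)"
      using that by (subst H.int_pow_mult) (simp_all add: H.int_pow_pow[symmetric] int_pow_int H.int_pow_one)
    finally show ?thesis by simp
  qed
  have conj1: "h [^]\<^bsub>H\<^esub> b \<otimes>\<^bsub>H\<^esub> g = g \<otimes>\<^bsub>H\<^esub> h [^]\<^bsub>H\<^esub> (b * s)" if "b \<ge> 0" for b :: int
    using that
  proof (induction b rule: int_ge_induct)
    case (step b)
    have "h [^]\<^bsub>H\<^esub> (b + 1) \<otimes>\<^bsub>H\<^esub> g = h [^]\<^bsub>H\<^esub> b \<otimes>\<^bsub>H\<^esub> (g \<otimes>\<^bsub>H\<^esub> h [^]\<^bsub>H\<^esub> s)"
      by (simp add: H.int_pow_mult H.m_assoc rel)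
    also have "\<dots> = g \<otimes>\<^bsub>H\<^esub> (h [^]\<^bsub>H\<^esub> (b * s) \<otimes>\<^bsub>H\<^esub> h [^]\<^bsub>H\<^esub> s)"
      by (simp add: step.IH H.m_assoc flip: H.m_assoc[of "h [^]\<^bsub>H\<^esub> b"])
    also have "\<dots> = g \<otimes>\<^bsub>H\<^esub> h [^]\<^bsub>H\<^esub> ((b + 1) * s)"
      by (simp add: distrib_right flip: H.int_pow_mult)
    finally show ?case .
  qed simp
  have conj1': "h [^]\<^bsub>H\<^esub> b \<otimes>\<^bsub>H\<^esub> g = g \<otimes>\<^bsub>H\<^esub> h [^]\<^bsub>H\<^esub> (b * s)" for b :: int
  proof -
    have "h [^]\<^bsub>H\<^esub> b \<otimes>\<^bsub>H\<^esub> g = g \<otimes>\<^bsub>H\<^esub> h [^]\<^bsub>H\<^esub> ((b mod int n) * s)"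
      using conj1[of "b mod int n"] assms(2) by (simp add: red hn)
    also have "h [^]\<^bsub>H\<^esub> ((b mod int n) * s) = h [^]\<^bsub>H\<^esub> (b * s)"
      by (metis \<open>h \<in> carrier H\<close> hn mod_mult_left_eq red)
    finally show ?thesis .
  qed
  have conj2: "h [^]\<^bsub>H\<^esub> b \<otimes>\<^bsub>H\<^esub> g [^]\<^bsub>H\<^esub> c = g [^]\<^bsub>H\<^esub> c \<otimes>\<^bsub>H\<^esub> h [^]\<^bsub>H\<^esub> (b * s ^ c)" for b :: int and c :: nat
  proof (induction c)
    case (Suc c)
    have "h [^]\<^bsub>H\<^esub> b \<otimes>\<^bsub>H\<^esub> g [^]\<^bsub>H\<^esub> Suc c = g [^]\<^bsub>H\<^esub> c \<otimes>\<^bsub>H\<^esub> (h [^]\<^bsub>H\<^esub> (b * s ^ c) \<otimes>\<^bsub>H\<^esub> g)"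
      by (simp add: Suc.IH H.m_assoc flip: H.m_assoc[of "h [^]\<^bsub>H\<^esub> b"])
    also have "\<dots> = g [^]\<^bsub>H\<^esub> Suc c \<otimes>\<^bsub>H\<^esub> h [^]\<^bsub>H\<^esub> (b * s ^ Suc c)"
      by (simp add: conj1' H.m_assoc mult.commute mult.left_commute)
    finally show ?case .
  qed simp
  show ?thesis
  proof (rule homI, goal_cases)
    case (1 p)
    then show ?case by (auto simp: case_prod_beta)
  next
    case (2 p q)
    then obtain a b c d where pq: "p = (a, b)" "q = (c, d)" and c: "c \<ge> 0"
      using assms by (auto simp: carrier_metacyclic)
    have "h [^]\<^bsub>H\<^esub> b \<otimes>\<^bsub>H\<^esub> g [^]\<^bsub>H\<^esub> c = g [^]\<^bsub>H\<^esub> c \<otimes>\<^bsub>H\<^esub> h [^]\<^bsub>H\<^esub> (b * s ^ nat c)"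
      using conj2[of b "nat c"] c by (simp flip: int_pow_int)
    then have "g [^]\<^bsub>H\<^esub> a \<otimes>\<^bsub>H\<^esub> (h [^]\<^bsub>H\<^esub> b \<otimes>\<^bsub>H\<^esub> g [^]\<^bsub>H\<^esub> c) \<otimes>\<^bsub>H\<^esub> h [^]\<^bsub>H\<^esub> d
        = g [^]\<^bsub>H\<^esub> (a + c) \<otimes>\<^bsub>H\<^esub> h [^]\<^bsub>H\<^esub> (b * s ^ nat c + d)"
      by (simp add: H.int_pow_mult H.m_assoc)
    then show ?case
      by (simp add: pq red gm hn H.m_assoc)
  qed
qed

end

theory Submission
  imports Defs
begin

text \<open>
  Write \<open>G\<close> for the metacyclic group and \<open>H = \<langle>x\<^sup>2, y\<rangle>\<close> for its abelian subgroup of index two.  The element \<open>x\<^sup>2 y\<close>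
  has order \<open>l = lcm (m div 2) n\<close>, and the sequence that consists of \<open>l - 1\<close> copies of it and of \<open>x\<close> is
  product-one free.  Thus \<open>d(G) \<ge> l\<close> (\<open>lcm_le_small_davenport\<close>), which rules out
  \<open>d(G) = m + n - 2\<close> as soon as \<open>l \<ge> m + n - 1\<close>.

  If \<open>m div 2\<close> and \<open>n\<close> are coprime, then \<open>l = |H|\<close>, and equality follows from the upper bound
  \<open>d(G) \<le> |H|\<close> (\<open>product_one_free_size_le\<close>), which is a case of a theorem of Olson and White.
  Its proof counts products of subsequences of a free sequence \<open>S\<close>.  A term in \<open>H\<close>, a noncommuting
  pair outside \<open>H\<close>, and a commuting pair outside \<open>H\<close> together with a term of \<open>H\<close> that the pair does not
  centralize, each have as many products in \<open>H\<close> as a free sequence of the same length over \<open>H\<close> is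
  sure to have.  By the Moser--Scherk sumset bound (\<open>moser_scherk\<close>) these counts add up.  If such
  blocks cover \<open>S\<close> up to one term, then \<open>|S| \<le> |H|\<close>.  Otherwise an exchange argument
  (\<open>blocks_or_majority\<close>) shows that at least half of the terms commute with one element \<open>u\<close> outside \<open>H\<close>.
  A single term off the centralizer of \<open>u\<close> then spreads the products over three cosets of
  that centralizer (\<open>card_subproducts_three_cosets\<close>), and there are at least \<open>2 |S|\<close> products in all, so
  that \<open>|S| \<le> |H|\<close> again.

  The bound on the Gao constant follows from \<open>E(G) \<ge> d(G) + |G|\<close> (\<open>gao_constant_ge\<close>), which holds in
  every finite group.
\<close>

section \<open>A sumset bound in abelian groups\<close>

text \<open>
  This is a Cauchy--Davenport bound that survives in composite cyclic groups because \<open>\<one>\<close> has only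
  the trivial representation.  The proof is Dyson's \<open>e\<close>-transform: the elements of \<open>a B\<close> outside
  \<open>A\<close> move from \<open>B\<close> to \<open>A\<close>.  This keeps \<open>|A| + |B|\<close>, shrinks \<open>B\<close>, does not enlarge \<open>A B\<close>, and the
  representation of \<open>\<one>\<close> stays trivial.
\<close>

lemma (in comm_group) moser_scherk:
  assumes "finite A" "finite B" "A \<subseteq> carrier G" "B \<subseteq> carrier G" "\<one> \<in> A" "\<one> \<in> B"
    and "\<And>a b. a \<in> A \<Longrightarrow> b \<in> B \<Longrightarrow> a \<otimes> b = \<one> \<Longrightarrow> b = \<one>"
  shows "card A + card B \<le> card (A <#> B) + 1"
  using assms
proof (induction "card B" arbitrary: A B rule: less_induct)
  case less
  note A = \<open>finite A\<close> \<open>A \<subseteq> carrier G\<close> \<open>\<one> \<in> A\<close> and B = \<open>finite B\<close> \<open>B \<subseteq> carrier G\<close> \<open>\<one> \<in> B\<close>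
  note uniq = less.prems(7)
  have finAB: "finite (A <#> B)"
    using A(1) B(1) by (simp add: set_mult_def)
  show ?case
  proof (cases "\<forall>a\<in>A. \<forall>b\<in>B. a \<otimes> b \<in> A")
    case True
    \<comment> \<open>Each \<open>b \<in> B\<close> permutes \<open>A\<close>, so some element of \<open>A\<close> is an inverse of \<open>b\<close>.\<close>
    have "b = \<one>" if "b \<in> B" for b
    proof -
      have "inj_on (\<lambda>a. a \<otimes> b) A"
        using that A(2) B(2) by (intro inj_on_subset[OF inj_on_multc]) auto
      then have "(\<lambda>a. a \<otimes> b) ` A = A"
        using True that A(1) by (intro endo_inj_surj) auto
      then obtain a where "a \<in> A" "a \<otimes> b = \<one>"
        using A(3) by (metis imageE)
      then show ?thesis
        using uniq that by blast
    qed
    then have "B = {\<one>}"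
      using B(3) by blast
    moreover have "A \<subseteq> A <#> B"
      using A(2) B(3) by (force simp: set_mult_def)
    ultimately show ?thesis
      using card_mono[OF finAB] by fastforce
  next
    case False
    then obtain a b where ab: "a \<in> A" "b \<in> B" "a \<otimes> b \<notin> A" by blast
    have a: "a \<in> carrier G"
      using ab A by blast
    define N where "N = {x \<in> B. a \<otimes> x \<notin> A}"
    define A' where "A' = A \<union> (\<otimes>) a ` N"
    define B' where "B' = B - N"
    have N: "N \<subseteq> B" "b \<in> N" "finite N"
      using ab B(1) by (auto simp: N_def)
    have cA: "card A' = card A + card N"
    proof -
      have "inj_on ((\<otimes>) a) N"
        using a N B(2) by (intro inj_on_subset[OF inj_on_cmult]) auto
      moreover have "A \<inter> (\<otimes>) a ` N = {}"
        by (auto simp: N_def)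
      ultimately show ?thesis
        using A(1) N(3) by (simp add: A'_def card_Un_disjoint card_image)
    qed
    have cB: "card B = card B' + card N"
      using N B(1) by (simp add: B'_def card_Diff_subset card_mono)
    have "card N > 0"
      using N by (auto simp: card_gt_0_iff)
    have sub: "A' <#> B' \<subseteq> A <#> B"
    proof
      fix z assume "z \<in> A' <#> B'"
      then obtain x y where z: "z = x \<otimes> y" "x \<in> A'" "y \<in> B'"
        by (auto simp: set_mult_def)
      have y: "y \<in> B" "a \<otimes> y \<in> A" "y \<in> carrier G"
        using z B(2) by (auto simp: B'_def N_def)
      show "z \<in> A <#> B"
      proof (cases "x \<in> A")
        case True
        then show ?thesis using z y by (auto simp: set_mult_def)
      next
        case False
        then obtain c where c: "c \<in> N" "x = a \<otimes> c"
          using z by (auto simp: A'_def)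
        then have "z = (a \<otimes> y) \<otimes> c"
          using z y a N(1) B(2) by (auto simp: m_ac subset_iff)
        then show ?thesis
          using y c N by (auto simp: set_mult_def)
      qed
    qed
    have "card A' + card B' \<le> card (A' <#> B') + 1"
    proof (rule less.hyps)
      show "card B' < card B"
        using cB \<open>card N > 0\<close> by simp
      show "finite A'" "finite B'" "\<one> \<in> A'"
        using A B N by (auto simp: A'_def B'_def)
      show "A' \<subseteq> carrier G" "B' \<subseteq> carrier G"
        using A B N a by (auto simp: A'_def B'_def)
      show "\<one> \<in> B'"
        using B A ab a by (auto simp: B'_def N_def)
      fix x y assume xy: "x \<in> A'" "y \<in> B'" "x \<otimes> y = \<one>"
      have y: "y \<in> B" "a \<otimes> y \<in> A" "y \<in> carrier G"
        using xy B(2) by (auto simp: B'_def N_def)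
      show "y = \<one>"
      proof (cases "x \<in> A")
        case True
        then show ?thesis using xy y uniq by blast
      next
        case False
        then obtain c where c: "c \<in> N" "x = a \<otimes> c"
          using xy by (auto simp: A'_def)
        then have cc: "c \<in> B" "c \<in> carrier G"
          using N(1) B(2) by auto
        have "(a \<otimes> y) \<otimes> c = \<one>"
          using xy(3) y a c(2) cc by (simp add: m_ac)
        then have "c = \<one>"
          using uniq y cc by blast
        \<comment> \<open>Then \<open>a \<otimes> c = a\<close> lies in \<open>A\<close>, against \<open>c \<in> N\<close>.\<close>
        then show ?thesis
          using c ab(1) a by (simp add: N_def)
      qed
    qed
    also have "\<dots> \<le> card (A <#> B) + 1"
      using sub finAB by (simp add: card_mono)
    finally show ?thesis
      using cA cB by simp
  qed
qed

section \<open>Products of subsequences\<close>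

context group
begin

text \<open>
  The empty subsequence counts here, so \<open>\<one>\<close> always belongs to the set.  This makes concatenation of
  sequences correspond to multiplication of sets.
\<close>

definition subproducts :: "'a multiset \<Rightarrow> 'a set" where
  "subproducts S = {foldr (\<otimes>) gs \<one> | gs. mset gs \<subseteq># S}"

lemma subproductsI: "mset gs \<subseteq># S \<Longrightarrow> foldr (\<otimes>) gs \<one> \<in> subproducts S"
  by (auto simp: subproducts_def)

lemma one_in_subproducts [simp]: "\<one> \<in> subproducts S"
  using subproductsI[of "[]"] by simp

lemma subproducts_mono: "S \<subseteq># T \<Longrightarrow> subproducts S \<subseteq> subproducts T"
  by (auto simp: subproducts_def intro: subset_mset.order_trans)

lemma subproducts_subgroup:
  assumes "subgroup K G" "set_mset S \<subseteq> K"
  shows "subproducts S \<subseteq> K"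
proof -
  have "foldr (\<otimes>) gs \<one> \<in> K" if "set gs \<subseteq> K" for gs
    using that by (induction gs) (auto simp: subgroup.m_closed[OF assms(1)] subgroup.one_closed[OF assms(1)])
  then show ?thesis
    using assms(2) unfolding subproducts_def by (auto dest!: set_mset_mono)
qed

lemma subproducts_closed: "set_mset S \<subseteq> carrier G \<Longrightarrow> subproducts S \<subseteq> carrier G"
  using subproducts_subgroup[OF subgroup_self] .

lemma foldr_mult_append:
  assumes "set gs \<subseteq> carrier G" "set hs \<subseteq> carrier G"
  shows "foldr (\<otimes>) (gs @ hs) \<one> = foldr (\<otimes>) gs \<one> \<otimes> foldr (\<otimes>) hs \<one>"
  using assms by (induction gs) (auto simp: m_assoc)

lemma subproducts_mult:
  assumes "set_mset S \<subseteq> carrier G" "set_mset T \<subseteq> carrier G"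
    and "a \<in> subproducts S" "b \<in> subproducts T"
  shows "a \<otimes> b \<in> subproducts (S + T)"
proof -
  obtain gs hs where gs: "a = foldr (\<otimes>) gs \<one>" "mset gs \<subseteq># S"
    and hs: "b = foldr (\<otimes>) hs \<one>" "mset hs \<subseteq># T"
    using assms by (auto simp: subproducts_def)
  have "set gs \<subseteq> carrier G" "set hs \<subseteq> carrier G"
    using gs hs assms(1,2) by (auto dest!: set_mset_mono)
  then have "a \<otimes> b = foldr (\<otimes>) (gs @ hs) \<one>"
    using gs hs by (simp only: foldr_mult_append)
  then show ?thesis
    using subproductsI[of "gs @ hs" "S + T"] gs hs by (simp add: subset_mset.add_mono)
qed

lemma mem_subproducts: "g \<in># S \<Longrightarrow> g \<in> carrier G \<Longrightarrow> g \<in> subproducts S"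
  using subproductsI[of "[g]" S] by simp

lemma product_one_free_mono: "product_one_free G S \<Longrightarrow> T \<subseteq># S \<Longrightarrow> product_one_free G T"
  by (auto simp: product_one_free_def intro: subset_mset.order_trans)

lemma foldr_neq_one_if_free:
  "product_one_free G S \<Longrightarrow> mset gs \<subseteq># S \<Longrightarrow> gs \<noteq> [] \<Longrightarrow> foldr (\<otimes>) gs \<one> \<noteq> \<one>"
  by (force simp: product_one_free_def product_one_def)

text \<open>
  For a free sequence that is split in two, the two product sets satisfy the hypothesis of
  the Moser--Scherk bound.
\<close>

lemma subproducts_mult_eq_one:
  assumes free: "product_one_free G (S + T)"
    and "set_mset S \<subseteq> carrier G" "set_mset T \<subseteq> carrier G"
    and "a \<in> subproducts S" "b \<in> subproducts T" "a \<otimes> b = \<one>"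
  shows "b = \<one>"
proof -
  obtain gs hs where gs: "a = foldr (\<otimes>) gs \<one>" "mset gs \<subseteq># S"
    and hs: "b = foldr (\<otimes>) hs \<one>" "mset hs \<subseteq># T"
    using assms by (auto simp: subproducts_def)
  have "set gs \<subseteq> carrier G" "set hs \<subseteq> carrier G"
    using gs hs assms(2,3) by (auto dest!: set_mset_mono)
  then have "foldr (\<otimes>) (gs @ hs) \<one> = \<one>"
    using gs hs \<open>a \<otimes> b = \<one>\<close> by (simp only: foldr_mult_append)
  then have "gs @ hs = []"
    using foldr_neq_one_if_free[OF free, of "gs @ hs"] gs hs by (auto simp: subset_mset.add_mono)
  then show ?thesis
    using hs by simp
qed

text \<open>
  If a further term \<open>g\<close> gave no new product, right multiplication by \<open>g\<close> would permute the finite set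
  of products, and one of them would be the inverse of \<open>g\<close>.
\<close>

lemma card_subproducts_add:
  assumes fin: "finite (carrier G)" and free: "product_one_free G (S + T)"
    and S: "set_mset S \<subseteq> carrier G" and T: "set_mset T \<subseteq> carrier G"
  shows "card (subproducts S) + size T \<le> card (subproducts (S + T))"
  using free T
proof (induction T)
  case (add g T)
  let ?P = "subproducts (S + T)"
  have g: "g \<in> carrier G" and ST: "set_mset (S + T) \<subseteq> carrier G"
    and STg: "set_mset (S + add_mset g T) \<subseteq> carrier G"
    using S add.prems by auto
  have finP: "finite ?P" "finite (subproducts (S + add_mset g T))"
    using subproducts_closed[OF ST] subproducts_closed[OF STg] finite_subset[OF _ fin] by auto
  have IH: "card (subproducts S) + size T \<le> card ?P"
    using add.prems by (intro add.IH product_one_free_mono[OF add.prems(1)]) auto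
  have "\<exists>a\<in>?P. a \<otimes> g \<notin> ?P"
  proof (rule ccontr)
    assume "\<not> ?thesis"
    moreover have "inj_on (\<lambda>a. a \<otimes> g) ?P"
      using g subproducts_closed[OF ST] by (intro inj_on_subset[OF inj_on_multc])
    ultimately have "(\<lambda>a. a \<otimes> g) ` ?P = ?P"
      using finP by (intro endo_inj_surj) auto
    then obtain a where a: "a \<in> ?P" "a \<otimes> g = \<one>"
      using one_in_subproducts by (metis imageE)
    have "g = \<one>"
      by (rule subproducts_mult_eq_one[of "S + T" "{#g#}" a])
        (use a add.prems ST g in \<open>auto intro: mem_subproducts\<close>)
    then show False
      using foldr_neq_one_if_free[OF add.prems(1), of "[g]"] by simp
  qed
  then obtain a where a: "a \<in> ?P" "a \<otimes> g \<notin> ?P" by blast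
  have "a \<otimes> g \<in> subproducts ((S + T) + {#g#})"
    by (rule subproducts_mult) (use a ST g in \<open>auto intro: mem_subproducts\<close>)
  moreover have "?P \<subseteq> subproducts (S + add_mset g T)"
    by (rule subproducts_mono) simp
  ultimately have "insert (a \<otimes> g) ?P \<subseteq> subproducts (S + add_mset g T)"
    by simp
  from card_mono[OF finP(2) this] show ?case
    using IH a finP by simp
qed simp

lemma size_less_card_subproducts:
  assumes "finite (carrier G)" "product_one_free G S" "set_mset S \<subseteq> carrier G"
  shows "size S + 1 \<le> card (subproducts S)"
  using card_subproducts_add[of "{#}" S] assms by (simp add: subproducts_def)

end

section \<open>Abelian subgroups of index two\<close>

lemma (in group) subgroup_centralizer_elem:
  assumes u: "u \<in> carrier G"
  shows "subgroup {g \<in> carrier G. g \<otimes> u = u \<otimes> g} G"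
proof (rule subgroupI)
  fix a assume "a \<in> {g \<in> carrier G. g \<otimes> u = u \<otimes> g}"
  then have a: "a \<in> carrier G" "a \<otimes> u = u \<otimes> a" by auto
  have "inv a \<otimes> u = inv a \<otimes> (u \<otimes> a) \<otimes> inv a"
    using a u by (simp add: m_assoc)
  also have "\<dots> = u \<otimes> inv a"
    using a u by (simp add: m_assoc[symmetric] flip: a(2))
  finally show "inv a \<in> {g \<in> carrier G. g \<otimes> u = u \<otimes> g}"
    using a by simp
next
  fix a b assume "a \<in> {g \<in> carrier G. g \<otimes> u = u \<otimes> g}" "b \<in> {g \<in> carrier G. g \<otimes> u = u \<otimes> g}"
  then have ab: "a \<in> carrier G" "a \<otimes> u = u \<otimes> a" "b \<in> carrier G" "b \<otimes> u = u \<otimes> b" by auto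
  then have "a \<otimes> b \<otimes> u = u \<otimes> (a \<otimes> b)"
    using u by (metis m_assoc)
  then show "a \<otimes> b \<in> {g \<in> carrier G. g \<otimes> u = u \<otimes> g}"
    using ab by simp
qed (use u in auto)

text \<open>
  The index condition is expressed by products: two elements outside \<open>H\<close> multiply into \<open>H\<close>.
  The last condition forbids commutators of order two.  It keeps apart two cosets of a
  centralizer, which would coincide in the dihedral group of order eight for instance.
\<close>

locale abelian_index_two = group G for G (structure) +
  fixes H
  assumes finite_carrier: "finite (carrier G)"
    and H: "subgroup H G"
    and H_commute: "\<And>a b. a \<in> H \<Longrightarrow> b \<in> H \<Longrightarrow> a \<otimes> b = b \<otimes> a"
    and outside_mult: "\<And>a b. a \<in> carrier G - H \<Longrightarrow> b \<in> carrier G - H \<Longrightarrow> a \<otimes> b \<in> H"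
    and no_involution: "\<And>a b c. a \<in> carrier G \<Longrightarrow> b \<in> carrier G \<Longrightarrow> c \<in> carrier G \<Longrightarrow>
      a \<otimes> b = b \<otimes> a \<otimes> c \<Longrightarrow> c \<otimes> c = \<one> \<Longrightarrow> c = \<one>"
begin

text \<open>
  A sequence is rich if, inside \<open>H\<close>, it has as many products as the Moser--Scherk bound would give
  for a free sequence of that length over \<open>H\<close>, even though its own terms may lie outside \<open>H\<close>.
  A rich sequence is shorter than \<open>|H|\<close>.
\<close>

definition rich :: "'a multiset \<Rightarrow> bool" where
  "rich S \<longleftrightarrow> size S + 1 \<le> card (subproducts S \<inter> H)"

lemma H_carrier: "h \<in> H \<Longrightarrow> h \<in> carrier G"
  using subgroup.mem_carrier[OF H] .

lemma finite_H: "finite H"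
  using subgroup.subset[OF H] finite_carrier finite_subset by blast

lemma finite_subproducts: "set_mset S \<subseteq> carrier G \<Longrightarrow> finite (subproducts S)"
  using subproducts_closed finite_carrier finite_subset by blast

lemma rich_empty: "rich {#}"
proof -
  have "subproducts {#} \<inter> H = {\<one>}"
    using subgroup.one_closed[OF H] by (auto simp: subproducts_def)
  then show ?thesis
    by (simp add: rich_def)
qed

text \<open>
  The Moser--Scherk bound inside \<open>H\<close>; the hypothesis on representations of \<open>\<one>\<close> is the freeness of
  the concatenation.
\<close>

lemma rich_add:
  assumes "rich S" "rich T" and free: "product_one_free G (S + T)"
    and S: "set_mset S \<subseteq> carrier G" and T: "set_mset T \<subseteq> carrier G"
  shows "rich (S + T)"
proof -
  interpret H: comm_group "G\<lparr>carrier := H\<rparr>"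
    using subgroup_imp_group[OF H] H_commute by (auto intro: group.group_comm_groupI)
  let ?A = "subproducts S \<inter> H" and ?B = "subproducts T \<inter> H"
  have "card ?A + card ?B \<le> card (?A <#>\<^bsub>G\<lparr>carrier := H\<rparr>\<^esub> ?B) + 1"
  proof (rule H.moser_scherk)
    fix a b assume "a \<in> ?A" "b \<in> ?B" "a \<otimes>\<^bsub>G\<lparr>carrier := H\<rparr>\<^esub> b = \<one>\<^bsub>G\<lparr>carrier := H\<rparr>\<^esub>"
    then show "b = \<one>\<^bsub>G\<lparr>carrier := H\<rparr>\<^esub>"
      using subproducts_mult_eq_one[OF free S T, of a b] by simp
  qed (use finite_H subgroup.one_closed[OF H] in auto)
  also have "?A <#>\<^bsub>G\<lparr>carrier := H\<rparr>\<^esub> ?B \<subseteq> subproducts (S + T) \<inter> H"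
    using subproducts_mult[OF S T] subgroup.m_closed[OF H] by (auto simp: set_mult_def)
  then have "card (?A <#>\<^bsub>G\<lparr>carrier := H\<rparr>\<^esub> ?B) \<le> card (subproducts (S + T) \<inter> H)"
    using finite_H by (intro card_mono) auto
  finally show ?thesis
    using assms(1,2) by (simp add: rich_def)
qed

lemma richI:
  assumes "Y \<subseteq> subproducts S" "Y \<subseteq> H" "card Y = size S + 1"
  shows "rich S"
  using assms card_mono[of "subproducts S \<inter> H" Y] finite_H by (simp add: rich_def)

lemma rich_single:
  assumes "h \<in> H" and free: "product_one_free G {#h#}"
  shows "rich {#h#}"
proof (rule richI)
  have h: "h \<in> carrier G"
    using assms H_carrier by blast
  then show "{\<one>, h} \<subseteq> subproducts {#h#}"
    by (auto intro: mem_subproducts)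
  show "{\<one>, h} \<subseteq> H"
    using assms subgroup.one_closed[OF H] by simp
  have "h \<noteq> \<one>"
    using foldr_neq_one_if_free[OF free, of "[h]"] h by simp
  then show "card {\<one>, h} = size {#h#} + 1"
    by simp
qed

text \<open>
  Both orders of a noncommuting pair outside \<open>H\<close> give elements of \<open>H\<close>, so that two terms contribute
  two products different from \<open>\<one>\<close>.
\<close>

lemma rich_pair:
  assumes ab: "a \<in> carrier G - H" "b \<in> carrier G - H" "a \<otimes> b \<noteq> b \<otimes> a"
    and free: "product_one_free G {#a, b#}"
  shows "rich {#a, b#}"
proof (rule richI)
  show "{\<one>, a \<otimes> b, b \<otimes> a} \<subseteq> subproducts {#a, b#}"
    using ab subproductsI[of "[a, b]" "{#a, b#}"] subproductsI[of "[b, a]" "{#a, b#}"]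
    by (auto simp: add_mset_commute)
  show "{\<one>, a \<otimes> b, b \<otimes> a} \<subseteq> H"
    using ab outside_mult subgroup.one_closed[OF H] by simp
  have "a \<otimes> b \<noteq> \<one>" "b \<otimes> a \<noteq> \<one>"
    using foldr_neq_one_if_free[OF free, of "[a, b]"] foldr_neq_one_if_free[OF free, of "[b, a]"] ab
    by (auto simp: add_mset_commute)
  then show "card {\<one>, a \<otimes> b, b \<otimes> a} = size {#a, b#} + 1"
    using ab(3) by auto
qed

lemma outside_mult_H:
  assumes "a \<in> carrier G - H" "h \<in> H"
  shows "a \<otimes> h \<in> carrier G - H" "h \<otimes> a \<in> carrier G - H"
proof -
  have h: "h \<in> carrier G" "inv h \<in> H" and a: "a \<in> carrier G" "a \<notin> H"
    using assms H_carrier subgroup.m_inv_closed[OF H] by auto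
  have "a = (a \<otimes> h) \<otimes> inv h" "a = inv h \<otimes> (h \<otimes> a)"
    using h a by (simp_all add: m_assoc flip: m_assoc[of "inv h"])
  then show "a \<otimes> h \<in> carrier G - H" "h \<otimes> a \<in> carrier G - H"
    using h a subgroup.m_closed[OF H] by (metis DiffI m_closed)+
qed

text \<open>
  A pair outside \<open>H\<close> that commutes has only one product, but a term of \<open>H\<close> can be placed after
  it or inside it.  When the two placements differ, three terms contribute three products
  different from \<open>\<one>\<close>.
\<close>

lemma rich_triple:
  assumes ab: "a \<in> carrier G - H" "b \<in> carrier G - H" and h: "h \<in> H" "h \<otimes> b \<noteq> b \<otimes> h"
    and free: "product_one_free G {#a, b, h#}"
  shows "rich {#a, b, h#}"
proof (rule richI)
  let ?Y = "{\<one>, a \<otimes> b, a \<otimes> (b \<otimes> h), a \<otimes> (h \<otimes> b)}"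
  have carr: "a \<in> carrier G" "b \<in> carrier G" "h \<in> carrier G"
    using ab h H_carrier by auto
  show "?Y \<subseteq> subproducts {#a, b, h#}"
    using carr subproductsI[of "[a, b]" "{#a, b, h#}"] subproductsI[of "[a, b, h]" "{#a, b, h#}"]
      subproductsI[of "[a, h, b]" "{#a, b, h#}"]
    by (auto simp: add_mset_commute)
  show "?Y \<subseteq> H"
    using ab h outside_mult outside_mult_H subgroup.one_closed[OF H] by simp
  have "a \<otimes> b \<noteq> \<one>" "a \<otimes> (b \<otimes> h) \<noteq> \<one>" "a \<otimes> (h \<otimes> b) \<noteq> \<one>" "h \<noteq> \<one>"
    using foldr_neq_one_if_free[OF free, of "[a, b]"] foldr_neq_one_if_free[OF free, of "[a, b, h]"]
      foldr_neq_one_if_free[OF free, of "[a, h, b]"] foldr_neq_one_if_free[OF free, of "[h]"] carr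
    by (auto simp: add_mset_commute)
  moreover have "b \<otimes> h \<noteq> b" "h \<otimes> b \<noteq> b"
    using \<open>h \<noteq> \<one>\<close> carr by auto
  ultimately show "card ?Y = size {#a, b, h#} + 1"
    using h(2) carr by auto
qed

text \<open>
  All elements outside \<open>H\<close> act on \<open>H\<close> by the same automorphism, since they differ by elements of the
  abelian group \<open>H\<close>.
\<close>

lemma commute_outside:
  assumes h: "h \<in> H" and uv: "u \<in> carrier G - H" "v \<in> carrier G - H" and "h \<otimes> u = u \<otimes> h"
  shows "h \<otimes> v = v \<otimes> h"
proof -
  have carr: "h \<in> carrier G" "u \<in> carrier G" "v \<in> carrier G" "u \<notin> H"
    using uv h H_carrier by auto
  have "inv u \<notin> H"
    using carr subgroup.m_inv_closed[OF H] by force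
  define k where "k = inv u \<otimes> v"
  have k: "k \<in> H" "k \<in> carrier G"
    using uv carr outside_mult \<open>inv u \<notin> H\<close> by (simp_all add: k_def)
  have v: "v = u \<otimes> k"
    using carr by (simp add: k_def flip: m_assoc)
  have "h \<otimes> (u \<otimes> k) = u \<otimes> (h \<otimes> k)"
    using carr k assms(4) by (simp flip: m_assoc)
  also have "\<dots> = u \<otimes> k \<otimes> h"
    using carr k h H_commute[of h k] by (simp add: m_assoc)
  finally show ?thesis
    by (simp add: v)
qed

text \<open>
  The quotient of two commuting elements outside \<open>H\<close> is an element of \<open>H\<close> fixed by the common action
  of all outside elements.  Hence commuting is an equivalence relation outside \<open>H\<close>.
\<close>

lemma commute_outside_trans:
  assumes "a \<in> carrier G - H" "b \<in> carrier G - H" "c \<in> carrier G - H"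
    and ab: "a \<otimes> b = b \<otimes> a" and bc: "b \<otimes> c = c \<otimes> b"
  shows "a \<otimes> c = c \<otimes> a"
proof -
  have carr: "a \<in> carrier G" "b \<in> carrier G" "c \<in> carrier G" "b \<notin> H"
    using assms by auto
  have "inv b \<notin> H"
    using carr subgroup.m_inv_closed[OF H] by force
  define k where "k = a \<otimes> inv b"
  have k: "k \<in> H" "k \<in> carrier G"
    using assms carr outside_mult \<open>inv b \<notin> H\<close> by (simp_all add: k_def)
  have a: "a = k \<otimes> b"
    using carr by (simp add: k_def m_assoc)
  have "k \<otimes> b = b \<otimes> k"
  proof -
    have "k \<otimes> b \<otimes> b = b \<otimes> k \<otimes> b"
      using ab carr k by (simp add: a m_assoc)
    then show ?thesis
      using carr k by simp
  qed
  then have kc: "k \<otimes> c = c \<otimes> k"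
    using commute_outside[OF k(1)] assms by blast
  have "k \<otimes> b \<otimes> c = k \<otimes> c \<otimes> b"
    using carr k bc by (simp add: m_assoc)
  also have "\<dots> = c \<otimes> (k \<otimes> b)"
    using carr k kc by (simp add: m_assoc)
  finally show ?thesis
    by (simp add: a)
qed

section \<open>Decomposition into rich blocks\<close>

inductive block :: "'a multiset \<Rightarrow> bool" where
  single: "h \<in> H \<Longrightarrow> block {#h#}"
| pair: "a \<in> carrier G - H \<Longrightarrow> b \<in> carrier G - H \<Longrightarrow> a \<otimes> b \<noteq> b \<otimes> a \<Longrightarrow> block {#a, b#}"
| triple: "a \<in> carrier G - H \<Longrightarrow> b \<in> carrier G - H \<Longrightarrow> a \<otimes> b = b \<otimes> a \<Longrightarrow>
    h \<in> H \<Longrightarrow> h \<otimes> b \<noteq> b \<otimes> h \<Longrightarrow> block {#a, b, h#}"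

lemma rich_block: "block B \<Longrightarrow> product_one_free G B \<Longrightarrow> rich B"
  by (induction rule: block.induct) (auto intro: rich_single rich_pair rich_triple)

lemma rich_blocks:
  assumes "\<forall>B\<in>#Bs. block B" "set_mset (\<Sum>\<^sub># Bs) \<subseteq> carrier G" "product_one_free G (\<Sum>\<^sub># Bs)"
  shows "rich (\<Sum>\<^sub># Bs)"
  using assms
proof (induction Bs)
  case (add B Bs)
  then show ?case
    using product_one_free_mono[OF add.prems(3), of B] product_one_free_mono[OF add.prems(3), of "\<Sum>\<^sub># Bs"]
    using rich_add[of B "\<Sum>\<^sub># Bs"] rich_block[of B] by simp
qed (simp add: rich_empty)

text \<open>
  An exchange step.  If a block has more terms off the centralizer of \<open>u\<close> than on it, then its terms
  and a commuting pair \<open>u\<close>, \<open>v\<close> of unused terms can be regrouped into blocks.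
\<close>

lemma block_balanced_or_absorbs:
  assumes "block B" and uv: "u \<in> carrier G - H" "v \<in> carrier G - H" "u \<otimes> v = v \<otimes> u"
  shows "size {#g \<in># B. g \<otimes> u \<noteq> u \<otimes> g#} \<le> size {#g \<in># B. g \<otimes> u = u \<otimes> g#} \<or>
    (\<exists>Bs. (\<forall>B\<in>#Bs. block B) \<and> \<Sum>\<^sub># Bs = B + {#u, v#})"
  using \<open>block B\<close>
proof cases
  case (single h)
  show ?thesis
  proof (cases "h \<otimes> u = u \<otimes> h")
    case False
    then have "h \<otimes> v \<noteq> v \<otimes> h"
      using commute_outside[of h v u] single uv by auto
    then have "block {#u, v, h#}"
      using single uv by (intro block.triple)
    then show ?thesis
      using single by (intro disjI2 exI[of _ "{#{#u, v, h#}#}"]) auto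
  qed (simp add: single)
next
  case (pair a b)
  show ?thesis
  proof (cases "a \<otimes> u = u \<otimes> a \<or> b \<otimes> u = u \<otimes> b")
    case False
    then have "b \<otimes> v \<noteq> v \<otimes> b"
      using commute_outside_trans[of b v u] pair uv by auto
    then have "block {#a, u#}" "block {#b, v#}"
      using False pair uv by (auto intro: block.pair)
    then show ?thesis
      using pair by (intro disjI2 exI[of _ "{#{#a, u#}, {#b, v#}#}"]) auto
  qed (use pair in auto)
next
  case (triple a b h)
  show ?thesis
  proof (cases "a \<otimes> u = u \<otimes> a")
    case True
    then have "b \<otimes> u = u \<otimes> b"
      using commute_outside_trans[of b a u] triple uv by auto
    then show ?thesis
      using True triple by auto
  next
    case False
    then have "b \<otimes> u \<noteq> u \<otimes> b"
      using commute_outside_trans[of a b u] triple uv by auto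
    then have "b \<otimes> v \<noteq> v \<otimes> b"
      using commute_outside_trans[of b v u] triple uv by auto
    then have "block {#a, u#}" "block {#b, v#}" "block {#h#}"
      using False triple uv by (auto intro: block.intros)
    then show ?thesis
      using triple by (intro disjI2 exI[of _ "{#{#a, u#}, {#b, v#}, {#h#}#}"]) auto
  qed
qed

text \<open>
  A decomposition with a shortest remainder admits no exchange step.  If its remainder has two
  terms, these commute and lie outside \<open>H\<close>, and every block is balanced with respect to
  the centralizer of one of them.
\<close>

lemma blocks_or_majority:
  assumes "set_mset S \<subseteq> carrier G"
  obtains Bs R where "\<forall>B\<in>#Bs. block B" "S = \<Sum>\<^sub># Bs + R" "size R \<le> 1"
  | u where "u \<in># S" "u \<in> carrier G - H"
      "size {#g \<in># S. g \<otimes> u \<noteq> u \<otimes> g#} \<le> size {#g \<in># S. g \<otimes> u = u \<otimes> g#}"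
proof -
  define P where "P = (\<lambda>(Bs, R). (\<forall>B\<in>#Bs. block B) \<and> S = \<Sum>\<^sub># Bs + R)"
  have "P ({#}, S)"
    by (simp add: P_def)
  then obtain q where q: "P q" and least: "\<And>q'. P q' \<Longrightarrow> size (snd q) \<le> size (snd q')"
    using ex_has_least_nat[of P _ "\<lambda>q. size (snd q)"] by blast
  obtain Bs R where [simp]: "q = (Bs, R)" by force
  have Bs: "\<forall>B\<in>#Bs. block B" and S: "S = \<Sum>\<^sub># Bs + R"
    using q by (auto simp: P_def)
  show ?thesis
  proof (cases "size R \<le> 1")
    case True
    then show ?thesis using that(1) Bs S by blast
  next
    case False
    then have "size R = Suc (Suc (size R - 2))"
      by simp
    then obtain u T where T: "R = add_mset u T" "size T = Suc (size R - 2)"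
      by (metis size_eq_Suc_imp_eq_union size_add_mset nat.inject)
    then obtain v R' where "T = add_mset v R'"
      using size_eq_Suc_imp_eq_union by blast
    then have R: "R = {#u, v#} + R'"
      using T by simp
    have no_block: "\<not> block B" if "B \<subseteq># R" "B \<noteq> {#}" for B
    proof
      assume "block B"
      then have "P (add_mset B Bs, R - B)"
        using Bs S that by (simp add: P_def)
      then show False
        using least[of "(add_mset B Bs, R - B)"] that size_mset_mono[of B R] nonempty_has_size[of B]
        by (simp add: size_Diff_submset)
    qed
    have outside: "x \<in> carrier G - H" if "x \<in># R" for x
      using no_block[of "{#x#}"] that block.single[of x] assms S by auto
    have comm: "x \<otimes> y = y \<otimes> x" if "{#x, y#} \<subseteq># R" for x y
      using no_block[OF that] block.pair[of x y] outside[of x] outside[of y] mset_subset_eqD[OF that] by auto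
    have uv: "u \<in> carrier G - H" "v \<in> carrier G - H" "u \<otimes> v = v \<otimes> u"
      using outside comm[of u v] by (auto simp: R)
    let ?c = "\<lambda>T. size {#g \<in># T. g \<otimes> u = u \<otimes> g#}" and ?n = "\<lambda>T. size {#g \<in># T. g \<otimes> u \<noteq> u \<otimes> g#}"
    have "?n B \<le> ?c B" if B: "B \<in># Bs" for B
    proof (rule ccontr)
      assume "\<not> ?thesis"
      moreover have "block B"
        using Bs that by blast
      ultimately obtain Cs where Cs: "\<forall>B\<in>#Cs. block B" "\<Sum>\<^sub># Cs = B + {#u, v#}"
        using block_balanced_or_absorbs[OF _ uv] by blast
      obtain Ds where Ds: "Bs = add_mset B Ds"
        using multi_member_split[OF B] by blast
      have "S = \<Sum>\<^sub># (Ds + Cs) + R'"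
        unfolding S R Ds by (simp add: Cs(2))
      moreover have "\<forall>B\<in>#Ds + Cs. block B"
        using Bs Cs(1) by (auto simp: Ds)
      ultimately have "P (Ds + Cs, R')"
        by (simp add: P_def)
      from least[OF this] show False
        by (simp add: R)
    qed
    then have Bs_le: "?n (\<Sum>\<^sub># Bs) \<le> ?c (\<Sum>\<^sub># Bs)"
      by (induction Bs) (auto intro!: add_mono)
    have "?n R = 0"
    proof -
      have "x \<otimes> u = u \<otimes> x" if "x \<in># R" for x
        using that comm[of x u] by (cases "x = u") (auto simp: R insert_subset_eq_iff)
      then show ?thesis
        using filter_mset_cong[of R R _ "\<lambda>_. False"] by simp
    qed
    then have "?n S \<le> ?c S"
      using Bs_le unfolding S filter_union_mset size_union by linarith
    then show ?thesis
      using that(2)[of u] uv by (simp add: S R)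
  qed
qed

end

section \<open>Sequences concentrated on one centralizer\<close>

lemma (in group) subgroup_cancel_right:
  assumes "subgroup K G" "a \<in> carrier G" "b \<in> K" "a \<otimes> b \<in> K"
  shows "a \<in> K"
proof -
  have "b \<in> carrier G"
    using subgroup.mem_carrier[OF assms(1,3)] .
  then have "a = (a \<otimes> b) \<otimes> inv b"
    using assms by (simp add: m_assoc)
  then show ?thesis
    using assms subgroup.m_closed[OF assms(1)] subgroup.m_inv_closed[OF assms(1)] by metis
qed

context abelian_index_two
begin

lemma card_carrier_le: "card (carrier G) \<le> 2 * card H"
proof (cases "carrier G - H = {}")
  case True
  then show ?thesis
    using card_mono[OF finite_H, of "carrier G"] by simp
next
  case False
  then obtain u where u: "u \<in> carrier G - H" by blast
  then have "inj_on ((\<otimes>) u) (carrier G - H)"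
    by (intro inj_on_subset[OF inj_on_cmult]) auto
  then have "card (carrier G - H) \<le> card H"
    using u outside_mult finite_H by (intro card_inj_on_le) auto
  then show ?thesis
    using subgroup.subset[OF H] finite_H card_Diff_subset[of H "carrier G"] by simp
qed

lemma square_outside_central:
  assumes u: "u \<in> carrier G - H" and g: "g \<in> carrier G"
  shows "(u \<otimes> u) \<otimes> g = g \<otimes> (u \<otimes> u)"
proof (cases "g \<in> H")
  case True
  then show ?thesis
    using H_commute outside_mult u by blast
next
  case False
  have "(u \<otimes> u) \<otimes> u = u \<otimes> (u \<otimes> u)"
    using u by (simp add: m_assoc)
  then show ?thesis
    using commute_outside[of "u \<otimes> u" u g] outside_mult u g False by blast
qed

text \<open>
  Since \<open>u\<^sup>2\<close> is central, a conjugate \<open>c\<close> of \<open>u\<close> that commutes with \<open>u\<close> satisfies \<open>c\<^sup>2 = u\<^sup>2\<close>.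
  Then the commutator \<open>u\<^sup>-\<^sup>1 c\<close> squares to \<open>\<one>\<close>, so it is trivial.
\<close>

lemma conjugate_not_commuting:
  assumes u: "u \<in> carrier G - H" and g: "g \<in> carrier G" and c: "c \<in> carrier G" "c \<otimes> u = u \<otimes> c"
    and conj: "u \<otimes> g = g \<otimes> c"
  shows "g \<otimes> u = u \<otimes> g"
proof -
  have uc: "u \<in> carrier G"
    using u by simp
  have "g \<otimes> (u \<otimes> u) = (u \<otimes> u) \<otimes> g"
    using square_outside_central[OF u g] by simp
  also have "\<dots> = g \<otimes> (c \<otimes> c)"
    using uc g c conj by (metis m_assoc m_closed)
  finally have sq: "u \<otimes> u = c \<otimes> c"
    using uc g c by simp
  define k where "k = inv u \<otimes> c"
  have k: "k \<in> carrier G" "c = u \<otimes> k"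
    using uc c by (simp_all add: k_def flip: m_assoc)
  have "u \<otimes> k = k \<otimes> u"
    using uc k c by (metis l_cancel m_assoc m_closed)
  then have "c \<otimes> c = u \<otimes> u \<otimes> (k \<otimes> k)"
    using uc k by (metis m_assoc m_closed)
  then have "k \<otimes> k = \<one>"
    using sq uc k l_cancel_one[of "u \<otimes> u" "k \<otimes> k"] by simp
  moreover have "u \<otimes> g = g \<otimes> u \<otimes> k"
    using conj uc g k by (simp add: m_assoc)
  ultimately have "k = \<one>"
    using no_involution uc g k by blast
  then show ?thesis
    using conj k uc by simp
qed

text \<open>
  Let \<open>K\<close> be the centralizer of \<open>u\<close>, which contains the terms of \<open>W\<close>.  A single term \<open>g\<close> off \<open>K\<close> spreads the
  products over the left cosets \<open>K\<close>, \<open>g K\<close> and \<open>u g K\<close>; only the last one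
  costs a term of \<open>W\<close>, namely \<open>u\<close>.  If \<open>g K\<close> and \<open>u g K\<close> met, the conjugate of \<open>u\<close> by \<open>g\<close> would lie in \<open>K\<close>.
\<close>

lemma card_subproducts_three_cosets:
  assumes free: "product_one_free G W" and W: "set_mset W \<subseteq> {g \<in> carrier G. g \<otimes> u = u \<otimes> g}"
    and u: "u \<in># W" "u \<notin> H" and g: "g \<in> carrier G" "g \<otimes> u \<noteq> u \<otimes> g"
  shows "3 * size W + 2 \<le> card (subproducts (W + {#g#}))"
proof -
  define K where "K = {g \<in> carrier G. g \<otimes> u = u \<otimes> g}"
  have uc: "u \<in> carrier G"
    using u W by auto
  have K: "subgroup K G"
    unfolding K_def by (rule subgroup_centralizer_elem[OF uc])
  have "g \<notin> K" "u \<otimes> g \<notin> K"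
    using uc g by (auto simp: K_def m_assoc)
  obtain V where V: "W = add_mset u V"
    using multi_member_split[OF u(1)] by blast
  have carr: "set_mset W \<subseteq> carrier G" "set_mset V \<subseteq> carrier G"
    using W by (auto simp: V)
  have freeV: "product_one_free G V"
    using product_one_free_mono[OF free] by (simp add: V)
  let ?A = "subproducts W" and ?B = "(\<otimes>) g ` subproducts W" and ?D = "(\<otimes>) (u \<otimes> g) ` subproducts V"
  have inC: "?A \<subseteq> K" "subproducts V \<subseteq> K"
    using subproducts_subgroup[OF K, of W] subproducts_subgroup[OF K, of V] W by (auto simp: V K_def)
  have fin: "finite ?A" "finite ?B" "finite ?D"
    using finite_subproducts carr by auto
  have "?A \<inter> ?B = {}"
    using subgroup_cancel_right[OF K g(1)] \<open>g \<notin> K\<close> inC by blast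
  moreover have "?A \<inter> ?D = {}"
    using subgroup_cancel_right[OF K, of "u \<otimes> g"] \<open>u \<otimes> g \<notin> K\<close> inC uc g by blast
  moreover have "?B \<inter> ?D = {}"
  proof (rule ccontr)
    assume "\<not> ?thesis"
    then obtain a b where ab: "a \<in> ?A" "b \<in> subproducts V" "g \<otimes> a = u \<otimes> g \<otimes> b" by blast
    have abC: "a \<in> K" "b \<in> K" and abc: "a \<in> carrier G" "b \<in> carrier G"
      using ab inC by (auto simp: K_def)
    then have "a \<otimes> inv b \<in> K"
      using subgroup.m_closed[OF K] subgroup.m_inv_closed[OF K] by blast
    moreover have "u \<otimes> g = g \<otimes> (a \<otimes> inv b)"
    proof -
      have "u \<otimes> g = (u \<otimes> g \<otimes> b) \<otimes> inv b"
        using uc g abc by (simp add: m_assoc)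
      also have "\<dots> = g \<otimes> (a \<otimes> inv b)"
        using g abc by (simp add: m_assoc flip: ab(3))
      finally show ?thesis .
    qed
    ultimately show False
      using conjugate_not_commuting[of u g "a \<otimes> inv b"] u uc g by (auto simp: K_def)
  qed
  ultimately have "card (?A \<union> ?B \<union> ?D) = card ?A + card ?B + card ?D"
    using fin by (simp add: card_Un_disjoint Int_Un_distrib2)
  moreover have "card ?B = card ?A" "card ?D = card (subproducts V)"
    using subproducts_closed[OF carr(1)] subproducts_closed[OF carr(2)] uc g
    by (auto intro!: card_image inj_on_subset[OF inj_on_cmult])
  moreover have "size W + 1 \<le> card ?A" "size V + 1 \<le> card (subproducts V)"
    using size_less_card_subproducts[OF finite_carrier] free freeV carr by auto
  moreover have "card (?A \<union> ?B \<union> ?D) \<le> card (subproducts (W + {#g#}))"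
  proof (rule card_mono)
    show "finite (subproducts (W + {#g#}))"
      using carr g by (intro finite_subproducts) auto
    have "?A \<subseteq> subproducts (W + {#g#})"
      by (rule subproducts_mono) simp
    moreover have "?B \<subseteq> subproducts (W + {#g#})"
      using subproducts_mult[of "{#g#}" W g] mem_subproducts[of g "{#g#}"] carr g by auto
    moreover have "?D \<subseteq> subproducts (W + {#g#})"
    proof -
      have "u \<otimes> g \<in> subproducts {#u, g#}"
        using subproductsI[of "[u, g]" "{#u, g#}"] uc g by simp
      then show ?thesis
        using subproducts_mult[of "{#u, g#}" V "u \<otimes> g"] carr g uc by (auto simp: V add_mset_commute)
    qed
    ultimately show "?A \<union> ?B \<union> ?D \<subseteq> subproducts (W + {#g#})"
      by blast
  qed
  ultimately show ?thesis
    by (simp add: V)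
qed

lemma outside_not_central:
  assumes "a \<in> carrier G" "b \<in> carrier G" "a \<otimes> b \<noteq> b \<otimes> a" and u: "u \<in> carrier G - H"
  shows "\<exists>g\<in>carrier G. g \<otimes> u \<noteq> u \<otimes> g"
proof (rule ccontr)
  assume "\<not> ?thesis"
  then have *: "g \<otimes> u = u \<otimes> g" if "g \<in> carrier G" for g
    using that by blast
  show False
  proof (cases "a \<in> H"; cases "b \<in> H")
    assume "a \<in> H" "b \<notin> H"
    then show False using commute_outside[of a u b] * assms by auto
  next
    assume "a \<notin> H" "b \<in> H"
    then show False using commute_outside[of b u a] * assms by auto
  next
    assume "a \<notin> H" "b \<notin> H"
    then show False using commute_outside_trans[of a u b] *[of a] *[of b] assms by auto
  qed (use H_commute assms in blast)
qed

text \<open>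
  Either the blocks cover all but one term, and then richness bounds the length, or at least half of
  the terms lie in the centralizer of some \<open>u\<close> outside \<open>H\<close>.  In the second case the three
  cosets give about three products for every term in the centralizer and one for every other
  term, hence about \<open>2 |S|\<close> products in a group of order at most \<open>2 |H|\<close>.
\<close>

theorem product_one_free_size_le:
  assumes nonabelian: "x \<in> carrier G" "y \<in> carrier G" "x \<otimes> y \<noteq> y \<otimes> x"
    and S: "set_mset S \<subseteq> carrier G" and free: "product_one_free G S"
  shows "size S \<le> card H"
  using S
proof (cases rule: blocks_or_majority)
  case (1 Bs R)
  have "rich (\<Sum>\<^sub># Bs)"
    using 1 S product_one_free_mono[OF free] by (intro rich_blocks) auto
  then have "size (\<Sum>\<^sub># Bs) + 1 \<le> card (subproducts (\<Sum>\<^sub># Bs) \<inter> H)"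
    by (simp add: rich_def)
  also have "\<dots> \<le> card H"
    using finite_H by (intro card_mono) auto
  finally show ?thesis
    using 1 by simp
next
  case (2 u)
  define W where "W = {#g \<in># S. g \<otimes> u = u \<otimes> g#}"
  define E where "E = {#g \<in># S. g \<otimes> u \<noteq> u \<otimes> g#}"
  define K where "K = {g \<in> carrier G. g \<otimes> u = u \<otimes> g}"
  have SWE: "S = W + E"
    by (simp add: W_def E_def)
  have le: "size E \<le> size W"
    using 2 by (simp add: W_def E_def)
  have WC: "set_mset W \<subseteq> K"
    using S by (auto simp: W_def K_def)
  have freeW: "product_one_free G W"
    using product_one_free_mono[OF free] by (simp add: SWE)
  show ?thesis
  proof (cases "E = {#}")
    case True
    have K: "subgroup K G"
      unfolding K_def using 2 by (intro subgroup_centralizer_elem) simp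
    have sub: "subproducts S \<subseteq> K"
      using subproducts_subgroup[OF K] WC by (simp add: SWE True)
    \<comment> \<open>All products lie in \<open>K\<close>, and their translates by an element \<open>g\<close> of the group off \<open>K\<close> double them.\<close>
    obtain g where g: "g \<in> carrier G" "g \<otimes> u \<noteq> u \<otimes> g"
      using outside_not_central[OF nonabelian 2(2)] by blast
    have "g \<notin> K"
      using g by (simp add: K_def)
    let ?A = "subproducts S" and ?B = "(\<otimes>) g ` subproducts S"
    have "?A \<inter> ?B = {}"
      using subgroup_cancel_right[OF K g(1)] \<open>g \<notin> K\<close> sub by blast
    then have "card (?A \<union> ?B) = card ?A + card ?B"
      using finite_subproducts[OF S] by (intro card_Un_disjoint) auto
    moreover have "card ?B = card ?A"
      using subproducts_closed[OF S] g by (intro card_image inj_on_subset[OF inj_on_cmult]) auto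
    moreover have "card (?A \<union> ?B) \<le> card (carrier G)"
      using subproducts_closed[OF S] g finite_carrier by (intro card_mono) auto
    ultimately show ?thesis
      using size_less_card_subproducts[OF finite_carrier free S] card_carrier_le by simp
  next
    case False
    then obtain g F where E: "E = add_mset g F"
      by (meson multiset_cases)
    have "g \<in># E"
      by (simp add: E)
    then have g: "g \<in> carrier G" "g \<otimes> u \<noteq> u \<otimes> g"
      using S by (auto simp: E_def)
    have "u \<in># W" "u \<notin> H"
      using 2 by (auto simp: W_def)
    then have "3 * size W + 2 \<le> card (subproducts (W + {#g#}))"
      using card_subproducts_three_cosets[OF freeW WC[unfolded K_def]] g by blast
    moreover have "card (subproducts (W + {#g#})) + size F \<le> card (subproducts (W + {#g#} + F))"
      by (rule card_subproducts_add[OF finite_carrier]) (use S free in \<open>auto simp: SWE E\<close>)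
    moreover have "card (subproducts (W + {#g#} + F)) \<le> card (carrier G)"
      using S by (intro card_mono finite_carrier subproducts_closed) (auto simp: SWE E)
    ultimately show ?thesis
      using le card_carrier_le by (simp add: SWE E)
  qed
qed

end

section \<open>The two constants in a finite group\<close>

lemma (in group) size_le_small_davenport:
  assumes "finite (carrier G)" "set_mset S \<subseteq> carrier G" "product_one_free G S"
  shows "size S \<le> small_davenport G"
  unfolding small_davenport_def using finite_free_lengths[OF assms(1)] assms(2,3)
  by (intro Max_ge) auto

lemma (in group) small_davenport_attained:
  assumes "finite (carrier G)"
  obtains S where "set_mset S \<subseteq> carrier G" "product_one_free G S" "size S = small_davenport G"
proof -
  have "small_davenport G \<in> {size S | S. set_mset S \<subseteq> carrier G \<and> product_one_free G S}"
    unfolding small_davenport_def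
    using finite_free_lengths[OF assms] free_lengths_nonempty by (intro Max_in)
  then obtain S where "set_mset S \<subseteq> carrier G" "product_one_free G S" "size S = small_davenport G"
    by fastforce
  then show ?thesis
    by (rule that)
qed

lemma (in group) foldr_mult_remove_ones:
  assumes "set gs \<subseteq> carrier G"
  shows "foldr (\<otimes>) (filter (\<lambda>g. g \<noteq> \<one>) gs) \<one> = foldr (\<otimes>) gs \<one>"
  using assms by (induction gs) auto

text \<open>
  Append \<open>|G| - 1\<close> copies of \<open>\<one>\<close> to a longest free sequence.  A subsequence of length \<open>|G|\<close> must use a
  term of the free part, and the copies of \<open>\<one>\<close> do not change its products.
\<close>

lemma (in group) gao_constant_ge:
  assumes fin: "finite (carrier G)"
  shows "order G + small_davenport G \<le> gao_constant G"
proof (rule ccontr)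
  assume "\<not> ?thesis"
  then have less: "gao_constant G < order G + small_davenport G"
    by simp
  obtain S where S: "set_mset S \<subseteq> carrier G" "product_one_free G S" "size S = small_davenport G"
    using small_davenport_attained[OF fin] .
  have pos: "order G > 0"
    using fin by (simp add: order_gt_0_iff_finite)
  let ?S = "S + replicate_mset (order G - 1) \<one>"
  have "\<forall>S. set_mset S \<subseteq> carrier G \<and> size S \<ge> gao_constant G \<longrightarrow>
      (\<exists>T. T \<subseteq># S \<and> size T = order G \<and> product_one G T)"
    using LeastI_ex[OF gao_constant_exists[OF fin], folded gao_constant_def] by (rule conjunct2)
  moreover have "set_mset ?S \<subseteq> carrier G" "gao_constant G \<le> size ?S"
    using S less pos by (auto split: if_splits)
  ultimately obtain T where T: "T \<subseteq># ?S" "size T = order G" "product_one G T"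
    by blast
  then obtain gs where gs: "mset gs = T" "foldr (\<otimes>) gs \<one> = \<one>"
    by (auto simp: product_one_def)
  let ?hs = "filter (\<lambda>g. g \<noteq> \<one>) gs"
  have "set gs \<subseteq> carrier G"
    using set_mset_mono[OF T(1)] S gs by (auto split: if_splits)
  then have prod: "foldr (\<otimes>) ?hs \<one> = \<one>"
    using foldr_mult_remove_ones gs by simp
  have one: "\<one> \<notin># S"
    using foldr_neq_one_if_free[OF S(2), of "[\<one>]"] by auto
  have ones: "filter_mset (\<lambda>g. g \<noteq> \<one>) (replicate_mset k \<one>) = {#}" for k
    by (induction k) auto
  have "filter_mset (\<lambda>g. g \<noteq> \<one>) T \<subseteq># filter_mset (\<lambda>g. g \<noteq> \<one>) ?S"
    using T(1) by (rule multiset_filter_mono)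
  also have "\<dots> \<subseteq># S"
    unfolding filter_union_mset ones by simp
  finally have "mset ?hs \<subseteq># S"
    by (simp add: gs)
  then have "?hs = []"
    using foldr_neq_one_if_free[OF S(2)] prod by blast
  then have "set gs \<subseteq> {\<one>}"
    by (auto simp: filter_empty_conv)
  then have "T = replicate_mset (order G) \<one>"
    using gs(1) T(2) by (metis set_mset_mset set_mset_subset_singletonD)
  then have "order G \<le> count ?S \<one>"
    using mset_subset_eq_count[OF T(1), of \<one>] by simp
  then show False
    using one pos by (simp add: not_in_iff)
qed

section \<open>The metacyclic group\<close>

lemma ord_int_eq_2:
  fixes s :: int
  assumes "n > 0" "ord (int n) s = 2"
  shows "[s ^ 2 = 1] (mod int n)" "\<not> [s = 1] (mod int n)"
proof -
  let ?P = "\<lambda>d. d > 0 \<and> [s ^ d = 1] (mod int n)"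
  have cop: "coprime (int n) s" and least: "Least ?P = 2"
    using assms(2) by (auto simp: ord_def split: if_splits)
  define a where "a = nat (s mod int n)"
  have a: "[int a = s] (mod int n)"
    using assms(1) by (simp add: a_def)
  then have "coprime (int a) (int n)"
    using cop cong_imp_coprime[OF cong_sym[OF a]] by (simp add: coprime_commute)
  then have "[int (a ^ totient n) = int 1] (mod int n)"
    using euler_theorem[of a n] by (simp only: coprime_int_iff cong_int_iff)
  then have "[s ^ totient n = 1] (mod int n)"
    using cong_trans[OF cong_sym[OF cong_pow[OF a]]] by simp
  then have "?P (totient n)"
    using assms(1) by simp
  then have "?P (Least ?P)"
    by (rule LeastI)
  then show "[s ^ 2 = 1] (mod int n)"
    by (simp add: least)
  show "\<not> [s = 1] (mod int n)"
    using not_less_Least[of 1 ?P] least by simp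
qed

lemma power_even_cong_1:
  fixes s :: int
  assumes "[s ^ 2 = 1] (mod N)" "even k"
  shows "[s ^ k = 1] (mod N)"
  using assms cong_pow[OF assms(1), of "k div 2"] by (simp flip: power_mult)

lemma even_mod_iff:
  "even m \<Longrightarrow> even (a mod int m) \<longleftrightarrow> even a"
  by (simp add: dvd_mod_iff)

lemma card_even_below: "card {a \<in> {0..<int m}. even a} = (m + 1) div 2"
proof -
  have "{a \<in> {0..<int m}. even a} = (\<lambda>k. 2 * int k) ` {..<(m + 1) div 2}"
  proof (intro equalityI subsetI)
    fix a assume a: "a \<in> {a \<in> {0..<int m}. even a}"
    then have "a = 2 * int (nat (a div 2))" "nat (a div 2) < (m + 1) div 2"
      by auto
    then show "a \<in> (\<lambda>k. 2 * int k) ` {..<(m + 1) div 2}"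
      by blast
  qed auto
  then show ?thesis
    by (simp add: card_image inj_on_def)
qed

text \<open>
  As \<open>s\<^sup>2 \<equiv> 1\<close>, the element \<open>x\<^sup>2\<close> is central, so \<open>H = \<langle>x\<^sup>2, y\<rangle>\<close> is abelian.  Commutators lie in \<open>\<langle>y\<rangle>\<close>, which
  has odd order.
\<close>

lemma metacyclic_abelian_index_two:
  fixes m n :: nat and s :: int
  assumes m: "m > 0" "even m" and n: "odd n" and s: "[s ^ 2 = 1] (mod int n)"
  shows "abelian_index_two (metacyclic m n s) ({a \<in> {0..<int m}. even a} \<times> {0..<int n})"
    (is "abelian_index_two ?G ?H")
proof -
  have n0: "n > 0"
    using n by (rule odd_pos)
  have "[s ^ m = 1] (mod int n)"
    using power_even_cong_1[OF s m(2)] .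
  then interpret group ?G
    using group_metacyclic m(1) n0 by blast
  note carr = carrier_metacyclic[OF m(1) n0, of s]
  show ?thesis
  proof (intro abelian_index_two.intro abelian_index_two_axioms.intro)
    show "group ?G"
      by (rule is_group)
    show "finite (carrier ?G)"
      by (simp add: carr)
    show "subgroup ?H ?G"
    proof (rule subgroupI)
      fix p assume p: "p \<in> ?H"
      then have pc: "p \<in> carrier ?G"
        by (auto simp: carr)
      obtain a b c d where abcd: "p = (a, b)" "inv\<^bsub>?G\<^esub> p = (c, d)"
        by (metis surj_pair)
      have "(c + a) mod int m = 0"
        using l_inv[OF pc] abcd by simp
      then have "even c"
        using p abcd even_mod_iff[OF m(2), of "c + a"] by simp
      then show "inv\<^bsub>?G\<^esub> p \<in> ?H"
        using inv_closed[OF pc] abcd by (auto simp: carr)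
    next
      have "(0, 0) \<in> ?H"
        using m n0 by simp
      then show "?H \<noteq> {}"
        by blast
    next
      fix p q assume "p \<in> ?H" "q \<in> ?H"
      then show "p \<otimes>\<^bsub>?G\<^esub> q \<in> ?H"
        using m n0 by (auto simp: even_mod_iff)
    next
      show "?H \<subseteq> carrier ?G"
        by (auto simp: carr)
    qed
  next
    fix p q assume "p \<in> ?H" "q \<in> ?H"
    then obtain a b c d where pq: "p = (a, b)" "q = (c, d)" and e: "even a" "even c" "a \<ge> 0" "c \<ge> 0"
      by auto
    have "[b * s ^ nat c + d = b * 1 + d] (mod int n)" "[d * s ^ nat a + b = d * 1 + b] (mod int n)"
      using e by (intro cong_add cong_mult cong_refl power_even_cong_1[OF s]; simp add: even_nat_iff)+
    then show "p \<otimes>\<^bsub>?G\<^esub> q = q \<otimes>\<^bsub>?G\<^esub> p"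
      by (simp add: pq cong_def add.commute)
  next
    fix p q assume "p \<in> carrier ?G - ?H" "q \<in> carrier ?G - ?H"
    then show "p \<otimes>\<^bsub>?G\<^esub> q \<in> ?H"
      using m n0 by (auto simp: carr even_mod_iff)
  next
    fix p q r assume pqr: "p \<in> carrier ?G" "q \<in> carrier ?G" "r \<in> carrier ?G"
      and pq: "p \<otimes>\<^bsub>?G\<^esub> q = q \<otimes>\<^bsub>?G\<^esub> p \<otimes>\<^bsub>?G\<^esub> r" and rr: "r \<otimes>\<^bsub>?G\<^esub> r = \<one>\<^bsub>?G\<^esub>"
    obtain a b c d e f where eqs: "p = (a, b)" "q = (c, d)" "r = (e, f)"
      by (metis surj_pair)
    have "(a + c) mod int m = ((c + a) mod int m + e) mod int m"
      using pq by (simp add: eqs)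
    then have "[a + c + 0 = a + c + e] (mod int m)"
      unfolding mod_add_left_eq by (simp add: cong_def add.commute)
    then have "[0 = e] (mod int m)"
      by (simp only: cong_add_lcancel)
    then have "e = 0"
      using pqr by (auto simp: eqs carr cong_def)
    then have "int n dvd 2 * f"
      using rr by (simp add: eqs dvd_eq_mod_eq_0)
    then have "int n dvd f"
      using n by (simp add: coprime_dvd_mult_right_iff)
    then have "f = 0"
      using pqr zdvd_not_zless[of f "int n"] order_le_less[of 0 f] by (auto simp: eqs carr)
    with \<open>e = 0\<close> show "r = \<one>\<^bsub>?G\<^esub>"
      by (simp add: eqs)
  qed
qed

lemma even_fst_foldr_metacyclic:
  assumes "even m"
  shows "even (fst (foldr (\<otimes>\<^bsub>metacyclic m n s\<^esub>) gs (0, 0))) \<longleftrightarrow> even (\<Sum>g\<leftarrow>gs. fst g)"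
proof (induction gs)
  case (Cons g gs)
  obtain a b c d where "g = (a, b)" "foldr (\<otimes>\<^bsub>metacyclic m n s\<^esub>) gs (0, 0) = (c, d)"
    by (metis surj_pair)
  then show ?case
    using Cons by (simp add: even_mod_iff[OF assms])
qed simp

lemma foldr_replicate_x2y:
  assumes m: "m > 0" "even m" and s: "[s ^ 2 = 1] (mod int n)"
  shows "foldr (\<otimes>\<^bsub>metacyclic m n s\<^esub>) (replicate k (2, 1)) (0, 0) = (2 * int k mod int m, int k mod int n)"
proof (induction k)
  case (Suc k)
  have "even (nat (2 * int k mod int m))"
    using m by (simp add: even_nat_iff even_mod_iff)
  then have "[1 * s ^ nat (2 * int k mod int m) + int k mod int n = 1 * 1 + int k] (mod int n)"
    by (intro cong_add cong_mult cong_refl power_even_cong_1[OF s]) simp_all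
  then show ?case
    using Suc by (simp add: cong_def mod_add_right_eq add.commute del: foldr_replicate)
qed simp

text \<open>
  The element \<open>x\<^sup>2 y\<close> has order \<open>l = lcm (m div 2) n\<close>, so \<open>l - 1\<close> copies of it form a free sequence.
  Adding the term \<open>x\<close> keeps it free, since a product that uses \<open>x\<close> once has an odd exponent
  of \<open>x\<close> and \<open>m\<close> is even.
\<close>

lemma lcm_le_small_davenport:
  fixes m n :: nat and s :: int
  assumes m: "m > 2" "even m" and n: "n > 1" and s: "[s ^ 2 = 1] (mod int n)"
  shows "lcm (m div 2) n \<le> small_davenport (metacyclic m n s)"
proof -
  let ?G = "metacyclic m n s"
  define L where "L = lcm (m div 2) n"
  have "L > 0"
    using m n by (auto simp: L_def lcm_pos_nat)
  have m0: "m > 0" and n0: "n > 0"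
    using m n by auto
  have "[s ^ m = 1] (mod int n)"
    using power_even_cong_1[OF s m(2)] .
  then interpret group ?G
    using group_metacyclic m0 n0 by blast
  let ?S = "add_mset (1, 0) (replicate_mset (L - 1) (2, 1)) :: (int \<times> int) multiset"
  have "product_one_free ?G ?S"
    unfolding product_one_free_def
  proof (intro allI impI notI)
    fix T assume T: "T \<subseteq># ?S \<and> T \<noteq> {#}" and "product_one ?G T"
    then obtain gs where gs: "mset gs = T" "foldr (\<otimes>\<^bsub>?G\<^esub>) gs (0, 0) = (0, 0)"
      by (auto simp: product_one_def)
    show False
    proof (cases "(1, 0) \<in># T")
      case True
      then have "T - {#(1, 0)#} \<subseteq># replicate_mset (L - 1) (2, 1)"
        using T by (simp add: subset_eq_diff_conv)
      then obtain k where "T - {#(1, 0)#} = replicate_mset k (2, 1)"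
        by (rule msubseteq_replicate_msetE)
      then have "T = add_mset (1, 0) (replicate_mset k (2, 1))"
        using True by (metis insert_DiffM)
      then have "(\<Sum>g\<leftarrow>gs. fst g) = 1 + int k * 2"
        using gs(1) by (simp flip: sum_mset_sum_list)
      moreover have "even (\<Sum>g\<leftarrow>gs. fst g)"
        using even_fst_foldr_metacyclic[OF m(2), of n s gs] gs(2) by simp
      ultimately show False
        by simp
    next
      case False
      then have "T \<subseteq># replicate_mset (L - 1) (2, 1)"
        using T by (metis diff_single_trivial subset_eq_diff_conv add_mset_add_single)
      then obtain k where k: "k \<le> L - 1" "T = replicate_mset k (2, 1)"
        by (rule msubseteq_replicate_msetE)
      then have "gs = replicate k (2, 1)"
        using gs(1) by (metis mset_replicate mset_eq_length_filter replicate_eqI size_mset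
            set_mset_mset size_replicate_mset in_replicate_mset)
      then have "2 * int k mod int m = 0" "int k mod int n = 0"
        using gs(2) foldr_replicate_x2y[OF m0 m(2) s] by auto
      then have "m dvd 2 * k" "n dvd k"
        by presburger+
      moreover have "m = 2 * (m div 2)"
        using m(2) by simp
      ultimately have "L dvd k"
        unfolding L_def by (metis lcm_least nat_mult_dvd_cancel1 zero_less_numeral)
      moreover have "k \<noteq> 0"
        using k T by auto
      ultimately show False
        using k \<open>L > 0\<close> dvd_imp_le[of L k] by simp
    qed
  qed
  then have "size ?S \<le> small_davenport ?G"
    using m n by (intro size_le_small_davenport) (auto simp: carrier_metacyclic split: if_splits)
  then show ?thesis
    using \<open>L > 0\<close> by (simp add: L_def)
qed

lemma small_davenport_le:
  fixes m n :: nat and s :: int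
  assumes m: "m > 0" "even m" and n: "odd n" and s: "[s ^ 2 = 1] (mod int n)" "\<not> [s = 1] (mod int n)"
  shows "small_davenport (metacyclic m n s) \<le> m div 2 * n"
proof -
  let ?G = "metacyclic m n s" and ?H = "{a \<in> {0..<int m}. even a} \<times> {0..<int n}"
  interpret abelian_index_two ?G ?H
    using metacyclic_abelian_index_two assms by blast
  have n0: "n > 0"
    using n by (rule odd_pos)
  have "n \<noteq> 1"
    using s(2) by auto
  then have "n > 1"
    using n0 by simp
  have "m > 1"
    using m by (cases "m = 1") auto
  obtain S where S: "set_mset S \<subseteq> carrier ?G" "product_one_free ?G S" "size S = small_davenport ?G"
    using small_davenport_attained[OF finite_carrier] .
  have "size S \<le> card ?H"
  proof (rule product_one_free_size_le[OF _ _ _ S(1,2)])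
    show "(1, 0) \<in> carrier ?G" "(0, 1) \<in> carrier ?G"
      using \<open>m > 1\<close> \<open>n > 1\<close> by (auto simp: carrier_metacyclic)
    show "(1, 0) \<otimes>\<^bsub>?G\<^esub> (0, 1) \<noteq> (0, 1) \<otimes>\<^bsub>?G\<^esub> (1, 0)"
      using s(2) by (auto simp: cong_def)
  qed
  also have "card ?H = m div 2 * n"
    using m unfolding card_cartesian_product card_even_below by simp
  finally show ?thesis
    by (simp add: S(3))
qed

theorem corollary2p3:
  fixes m n :: nat and s :: int
  assumes "m \<ge> 4" and "even m" and "n \<ge> 3" and "odd n"
    and "ord (int n) s = 2"
  shows "(lcm (m div 2) n \<ge> m + n - 1 \<longrightarrow>
            \<not> (small_davenport (metacyclic m n s) = m + n - 2 \<and>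
               gao_constant (metacyclic m n s) = m * n + m + n - 2)) \<and>
         (gcd (m div 2) n = 1 \<longrightarrow>
            small_davenport (metacyclic m n s) = m * n div 2 \<and>
            gao_constant (metacyclic m n s) \<ge> 3 * m * n div 2 \<and>
            \<not> (small_davenport (metacyclic m n s) = m + n - 2 \<and>
               gao_constant (metacyclic m n s) = m * n + m + n - 2))"
proof (intro conjI[of "_ \<longrightarrow> _"] impI)
  let ?G = "metacyclic m n s"
  have s: "[s ^ 2 = 1] (mod int n)" "\<not> [s = 1] (mod int n)"
    using ord_int_eq_2[of n s] assms by auto
  have lower: "lcm (m div 2) n \<le> small_davenport ?G"
    using assms s by (intro lcm_le_small_davenport) auto
  {
    assume "lcm (m div 2) n \<ge> m + n - 1"
    \<comment> \<open>The lower bound already exceeds \<open>m + n - 2\<close>.\<close>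
    then show "\<not> (small_davenport ?G = m + n - 2 \<and> gao_constant ?G = m * n + m + n - 2)"
      using lower assms by linarith
  next
    assume gcd: "gcd (m div 2) n = 1"
    obtain k where m: "m = 2 * k"
      using \<open>even m\<close> by blast
    interpret abelian_index_two ?G "{a \<in> {0..<int m}. even a} \<times> {0..<int n}"
      using metacyclic_abelian_index_two assms s by auto
    have "coprime k n"
      unfolding coprime_iff_gcd_eq_1 using gcd by (simp add: m)
    then have "lcm k n = k * n"
      by (simp add: lcm_coprime)
    then have d: "small_davenport ?G = k * n"
      using lower small_davenport_le[of m n s] assms s by (simp add: m)
    have "order ?G + small_davenport ?G \<le> gao_constant ?G"
      using gao_constant_ge[OF finite_carrier] .
    then have E: "gao_constant ?G \<ge> 3 * (k * n)"
      using assms by (simp add: order_metacyclic d) (simp add: m)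
    \<comment> \<open>This product is \<open>k n - (m + n - 2)\<close>.\<close>
    have "(k - 1) * (n - 2) \<ge> 1 * 1"
      using assms by (intro mult_mono) (auto simp: m)
    then have "k * n + 2 \<ge> 2 * k + n + 1"
      using assms by (simp add: m algebra_simps diff_mult_distrib diff_mult_distrib2)
    then have "small_davenport ?G \<noteq> m + n - 2"
      unfolding d using assms by (simp add: m)
    then show "small_davenport ?G = m * n div 2 \<and> gao_constant ?G \<ge> 3 * m * n div 2 \<and>
        \<not> (small_davenport ?G = m + n - 2 \<and> gao_constant ?G = m * n + m + n - 2)"
      using d E by (simp add: m)
  }
qed

end
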